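(* Let $(\alpha_n)_{n\ge 1}$ be a non-decreasing sequence of positive real numbers such that $\alpha_n\to\infty$ as $n\to\infty$. Then there exists a (strictly) increasing real sequence $(a_n)_{n\ge 0}$ with $a_0=0$ and $a_n>0$ for $n\ge1$, such that $a_n<\alpha_n$ for all sufficiently large $n$, $a_n\to\infty$ as $n\to\infty$, and $$1\le \frac{a_{n-1}-a_{n-2}}{a_n-a_{n-1}}<2,\qquad\text{for all } n\ge 2.$$ *)

theory Defs
  imports Complex_Main
begin

end

theory Submission
  imports Defs
begin

text \<open>
  A single saturating sequence \<open>n \<mapsto> 1 - (1 - \<epsilon>)^n\<close> starts at \<open>0\<close>, increases to \<open>1\<close>, and its
  increments are geometric with ratio \<open>1 - \<epsilon>\<close>. The required sequence is a superposition
  \<open>a n = (\<Sum>k. 1 - (1 - \<epsilon> k)^n)\<close> of infinitely many of these, with \<open>\<epsilon> k\<close> summable and at most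
  \<open>1/4\<close>. Bounds on the ratio of consecutive increments survive summation, so the increments of
  \<open>a\<close> decrease, but never by a factor of more than \<open>4/3\<close>. Moreover \<open>a\<close> is unbounded, because
  each of the infinitely many summands eventually contributes almost \<open>1\<close>.

  The growth of \<open>a\<close> is as slow as desired. The first \<open>K\<close> summands contribute at most \<open>K\<close>, and by
  Bernoulli's inequality the others contribute at most \<open>n\<close> times the tail of \<open>\<Sum>k. \<epsilon> k\<close> from \<open>K\<close>
  on, which is less than \<open>1\<close> as long as the later \<open>\<epsilon> k\<close> are small compared with \<open>1/n\<close>. Hence if
  \<open>\<epsilon> k\<close> is small compared with \<open>1 / N k\<close>, where \<open>\<alpha>\<close> exceeds \<open>k + 2\<close> from \<open>N k\<close> on, then
  \<open>a\<close> passes \<open>K + 1\<close> only after \<open>\<alpha>\<close> has done so.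
\<close>

definition saturation_sum :: "(nat \<Rightarrow> real) \<Rightarrow> nat \<Rightarrow> real" where
  "saturation_sum \<epsilon> n = (\<Sum>k. 1 - (1 - \<epsilon> k) ^ n)"

lemma one_minus_power_le:
  fixes e :: real
  assumes "e \<le> 1"
  shows "1 - (1 - e) ^ n \<le> real n * e"
  using Bernoulli_inequality[of "- e" n] assms by simp

context
  fixes \<epsilon> :: "nat \<Rightarrow> real"
  assumes pos: "\<And>k. 0 < \<epsilon> k"
    and le_quarter: "\<And>k. \<epsilon> k \<le> 1 / 4"
    and summable_eps: "summable \<epsilon>"
begin

lemma eps_bounds: "0 \<le> \<epsilon> k" "\<epsilon> k \<le> 1" "0 < 1 - \<epsilon> k" "1 - \<epsilon> k < 1"
  using pos[of k] le_quarter[of k] by linarith+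

lemma saturation_term_nonneg: "0 \<le> 1 - (1 - \<epsilon> k) ^ n"
  using power_le_one[of "1 - \<epsilon> k" n] eps_bounds[of k] by simp

lemma saturation_summable: "summable (\<lambda>k. 1 - (1 - \<epsilon> k) ^ n)"
proof (rule summable_comparison_test')
  show "summable (\<lambda>k. real n * \<epsilon> k)"
    using summable_eps by (rule summable_mult)
  show "norm (1 - (1 - \<epsilon> k) ^ n) \<le> real n * \<epsilon> k" for k
    using one_minus_power_le[of "\<epsilon> k" n] saturation_term_nonneg[of k n] eps_bounds[of k]
    by simp
qed

lemma increment_summable: "summable (\<lambda>k. \<epsilon> k * (1 - \<epsilon> k) ^ n)"
proof (rule summable_comparison_test'[OF summable_eps])
  show "norm (\<epsilon> k * (1 - \<epsilon> k) ^ n) \<le> \<epsilon> k" for k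
    using power_le_one[of "1 - \<epsilon> k" n] eps_bounds[of k]
    by (simp add: abs_mult mult_left_le)
qed

lemma saturation_sum_increment:
  "saturation_sum \<epsilon> (Suc n) - saturation_sum \<epsilon> n = (\<Sum>k. \<epsilon> k * (1 - \<epsilon> k) ^ n)"
  unfolding saturation_sum_def
  by (subst suminf_diff[OF saturation_summable saturation_summable])
     (simp add: algebra_simps)

lemma increment_pos: "0 < (\<Sum>k. \<epsilon> k * (1 - \<epsilon> k) ^ n)"
  by (intro suminf_pos increment_summable mult_pos_pos zero_less_power pos eps_bounds)

lemma increment_decreasing:
  "(\<Sum>k. \<epsilon> k * (1 - \<epsilon> k) ^ Suc n) \<le> (\<Sum>k. \<epsilon> k * (1 - \<epsilon> k) ^ n)"
proof (intro suminf_le increment_summable)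
  show "\<epsilon> k * (1 - \<epsilon> k) ^ Suc n \<le> \<epsilon> k * (1 - \<epsilon> k) ^ n" for k
    using eps_bounds[of k] by (intro mult_left_mono power_decreasing) auto
qed

text \<open>
  Every summand shrinks by the factor \<open>1 - \<epsilon> k\<close>, which is at least \<open>3/4\<close>; a uniform bound on
  the summands carries over to the sum.
\<close>

lemma increment_decreases_slowly:
  "3 / 4 * (\<Sum>k. \<epsilon> k * (1 - \<epsilon> k) ^ n) \<le> (\<Sum>k. \<epsilon> k * (1 - \<epsilon> k) ^ Suc n)"
proof -
  have "(\<Sum>k. 3 / 4 * (\<epsilon> k * (1 - \<epsilon> k) ^ n)) \<le> (\<Sum>k. \<epsilon> k * (1 - \<epsilon> k) ^ Suc n)"
  proof (intro suminf_le increment_summable summable_mult)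
    fix k
    have "3 / 4 * (\<epsilon> k * (1 - \<epsilon> k) ^ n) \<le> (1 - \<epsilon> k) * (\<epsilon> k * (1 - \<epsilon> k) ^ n)"
      using le_quarter[of k] eps_bounds[of k] by (intro mult_right_mono) auto
    then show "3 / 4 * (\<epsilon> k * (1 - \<epsilon> k) ^ n) \<le> \<epsilon> k * (1 - \<epsilon> k) ^ Suc n"
      by (simp add: mult_ac)
  qed
  then show ?thesis
    by (simp only: suminf_mult[OF increment_summable])
qed

lemma strict_mono_saturation_sum: "strict_mono (saturation_sum \<epsilon>)"
  unfolding strict_mono_Suc_iff
  using saturation_sum_increment increment_pos by (metis diff_gt_0_iff_gt)

lemma saturation_sum_ratio:
  fixes n :: nat
  defines "a \<equiv> saturation_sum \<epsilon>"
  assumes "n \<ge> 2"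
  shows "1 \<le> (a (n - 1) - a (n - 2)) / (a n - a (n - 1))"
    and "(a (n - 1) - a (n - 2)) / (a n - a (n - 1)) < 2"
proof -
  obtain m where n: "n = Suc (Suc m)"
    using assms(2) by (metis add_2_eq_Suc le_Suc_ex)
  define d where "d = (\<lambda>n. \<Sum>k. \<epsilon> k * (1 - \<epsilon> k) ^ n)"
  have d: "a (n - 1) - a (n - 2) = d m" "a n - a (n - 1) = d (Suc m)"
    using saturation_sum_increment[of m] saturation_sum_increment[of "Suc m"]
    unfolding a_def d_def n by simp_all
  have "0 < d m" "0 < d (Suc m)" "d (Suc m) \<le> d m" "3 / 4 * d m \<le> d (Suc m)"
    unfolding d_def
    by (rule increment_pos increment_decreasing increment_decreases_slowly)+
  then show "1 \<le> (a (n - 1) - a (n - 2)) / (a n - a (n - 1))"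
    and "(a (n - 1) - a (n - 2)) / (a n - a (n - 1)) < 2"
    unfolding d by (simp_all add: field_simps)
qed

text \<open>
  Any \<open>m\<close> of the summands already have a sum that tends to \<open>m\<close> as \<open>n\<close> grows.
\<close>

lemma saturation_sum_at_top: "filterlim (saturation_sum \<epsilon>) at_top sequentially"
  unfolding filterlim_at_top
proof
  fix Z :: real
  obtain m where m: "Z < real m"
    using reals_Archimedean2 by blast
  have "(\<lambda>n. \<Sum>k<m. 1 - (1 - \<epsilon> k) ^ n) \<longlonglongrightarrow> (\<Sum>k<m. 1 - 0)"
    using eps_bounds by (intro tendsto_intros LIMSEQ_power_zero) (simp add: less_imp_le)
  then have "\<forall>\<^sub>F n in sequentially. Z < (\<Sum>k<m. 1 - (1 - \<epsilon> k) ^ n)"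
    using m by (intro order_tendstoD(1)) auto
  then show "\<forall>\<^sub>F n in sequentially. Z \<le> saturation_sum \<epsilon> n"
  proof eventually_elim
    case (elim n)
    have "(\<Sum>k<m. 1 - (1 - \<epsilon> k) ^ n) \<le> saturation_sum \<epsilon> n"
      unfolding saturation_sum_def
      by (intro sum_le_suminf saturation_summable) (use saturation_term_nonneg in auto)
    with elim show ?case by linarith
  qed
qed

lemma saturation_sum_le:
  "saturation_sum \<epsilon> n \<le> real K + real n * (\<Sum>k. \<epsilon> (k + K))"
proof -
  have tail: "summable (\<lambda>k. \<epsilon> (k + K))"
    using summable_eps by (rule summable_ignore_initial_segment)
  have "(\<Sum>k. 1 - (1 - \<epsilon> (k + K)) ^ n) \<le> (\<Sum>k. real n * \<epsilon> (k + K))"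
  proof (intro suminf_le summable_mult tail)
    show "1 - (1 - \<epsilon> (k + K)) ^ n \<le> real n * \<epsilon> (k + K)" for k
      by (intro one_minus_power_le eps_bounds)
    show "summable (\<lambda>k. 1 - (1 - \<epsilon> (k + K)) ^ n)"
      using saturation_summable by (rule summable_ignore_initial_segment)
  qed
  also have "\<dots> = real n * (\<Sum>k. \<epsilon> (k + K))"
    using tail by (rule suminf_mult)
  finally have "(\<Sum>k. 1 - (1 - \<epsilon> (k + K)) ^ n) \<le> real n * (\<Sum>k. \<epsilon> (k + K))" .
  moreover have "(\<Sum>k<K. 1 - (1 - \<epsilon> k) ^ n) \<le> (\<Sum>k<K. 1)"
    using eps_bounds by (intro sum_mono) (simp add: less_imp_le)
  moreover have "saturation_sum \<epsilon> n =
      (\<Sum>k. 1 - (1 - \<epsilon> (k + K)) ^ n) + (\<Sum>k<K. 1 - (1 - \<epsilon> k) ^ n)"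
    unfolding saturation_sum_def
    by (rule suminf_split_initial_segment[OF saturation_summable])
  ultimately show ?thesis by simp
qed

end

text \<open>
  The thresholds \<open>N k\<close> are made strictly increasing so that the \<open>k\<close> with \<open>N k \<le> n\<close> form an
  initial segment of the naturals; its length \<open>K\<close> is where the sum has to be split.
\<close>

lemma thresholds_of_filterlim_at_top:
  fixes \<alpha> :: "nat \<Rightarrow> real"
  assumes "filterlim \<alpha> at_top sequentially"
  obtains N :: "nat \<Rightarrow> nat"
  where "strict_mono N" "\<And>k. 0 < N k" "\<And>k n. N k \<le> n \<Longrightarrow> real k + 2 < \<alpha> n"
proof -
  have "\<exists>M. \<forall>n\<ge>M. real k + 2 < \<alpha> n" for k
    using assms unfolding filterlim_at_top_dense eventually_sequentially by blast
  then obtain M where M: "\<And>k n. M k \<le> n \<Longrightarrow> real k + 2 < \<alpha> n"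
    by metis
  define N where "N k = Suc k + (\<Sum>j\<le>k. M j)" for k
  have "M k \<le> N k" for k
    unfolding N_def using member_le_sum[of k "{..k}" M] by simp
  then have "real k + 2 < \<alpha> n" if "N k \<le> n" for k n
    using M that le_trans by blast
  moreover have "strict_mono N"
    unfolding strict_mono_Suc_iff N_def by simp
  moreover have "0 < N k" for k
    by (simp add: N_def)
  ultimately show ?thesis using that by blast
qed

theorem theorem4p2:
  fixes \<alpha> :: "nat \<Rightarrow> real"
  assumes "mono_on {1..} \<alpha>"
    and "\<forall>n\<ge>1. \<alpha> n > 0"
    and "filterlim \<alpha> at_top sequentially"
  shows "\<exists>a :: nat \<Rightarrow> real.
    strict_mono a \<and>
    a 0 = 0 \<and>
    (\<forall>n\<ge>1. a n > 0) \<and>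
    (\<forall>\<^sub>F n in sequentially. a n < \<alpha> n) \<and>
    filterlim a at_top sequentially \<and>
    (\<forall>n\<ge>2. 1 \<le> (a (n - 1) - a (n - 2)) / (a n - a (n - 1)) \<and>
            (a (n - 1) - a (n - 2)) / (a n - a (n - 1)) < 2)"
proof -
  obtain N :: "nat \<Rightarrow> nat" where N: "strict_mono N" "\<And>k. 0 < N k"
    "\<And>k n. N k \<le> n \<Longrightarrow> real k + 2 < \<alpha> n"
    using thresholds_of_filterlim_at_top[OF assms(3)] by blast
  define \<epsilon> where "\<epsilon> k = (1 / 4) * (1 / 2) ^ k / real (N k)" for k
  have pos: "0 < \<epsilon> k" for k
    unfolding \<epsilon>_def using N(2)[of k] by simp
  have le_geometric: "\<epsilon> k \<le> (1 / 4) * (1 / 2) ^ k" for k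
    unfolding \<epsilon>_def using N(2)[of k] by (simp add: divide_le_eq Suc_le_eq)
  have le_quarter: "\<epsilon> k \<le> 1 / 4" for k
    using le_geometric[of k] power_le_one[of "1 / 2 :: real" k] by linarith
  have geometric: "summable (\<lambda>k. (1 / 4) * (1 / 2 :: real) ^ k)"
    by (intro summable_mult summable_geometric) simp
  have summable_eps: "summable \<epsilon>"
    by (rule summable_comparison_test'[OF geometric])
       (use pos le_geometric in \<open>simp add: less_imp_le\<close>)
  note eps = pos le_quarter summable_eps
  define a where "a = saturation_sum \<epsilon>"
  have a_mono: "strict_mono a"
    unfolding a_def using eps by (rule strict_mono_saturation_sum)
  have a_0: "a 0 = 0"
    by (simp add: a_def saturation_sum_def)
  have a_pos: "a n > 0" if "n \<ge> 1" for n
    using strict_monoD[OF a_mono, of 0 n] a_0 that by simp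
  have a_less: "a n < \<alpha> n" if n: "N 0 \<le> n" for n
  proof -
    define K where "K = (LEAST k. n < N k)"
    have "n < N (Suc n)"
      using strict_mono_imp_increasing[OF N(1), of "Suc n"] by simp
    then have NK: "n < N K"
      unfolding K_def by (rule LeastI)
    with n have "K \<noteq> 0"
      by (metis not_less)
    then obtain J where J: "K = Suc J"
      by (metis not0_implies_Suc)
    then have "N J \<le> n"
      using not_less_Least[of J "\<lambda>k. n < N k"] unfolding K_def by simp
    then have "real K + 1 < \<alpha> n"
      using N(3)[of J n] J by simp
    moreover have "real n * (\<Sum>k. \<epsilon> (k + K)) \<le> 1"
    proof -
      have tail: "summable (\<lambda>k. \<epsilon> (k + K))"
        using summable_eps by (rule summable_ignore_initial_segment)
      have "real n * (\<Sum>k. \<epsilon> (k + K)) = (\<Sum>k. real n * \<epsilon> (k + K))"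
        using tail by (rule suminf_mult[symmetric])
      also have "\<dots> \<le> (\<Sum>k. (1 / 4) * (1 / 2) ^ k)"
      proof (intro suminf_le summable_mult[OF tail] geometric)
        fix k
        have "N K \<le> N (k + K)"
          using N(1) by (simp add: strict_mono_less_eq)
        with NK have le: "real n \<le> real (N (k + K))"
          by simp
        have "real n * \<epsilon> (k + K) \<le> real (N (k + K)) * \<epsilon> (k + K)"
          using le pos[of "k + K"] by (intro mult_right_mono) auto
        also have "\<dots> = (1 / 4) * (1 / 2) ^ (k + K)"
          unfolding \<epsilon>_def using N(2)[of "k + K"] by simp
        also have "\<dots> \<le> (1 / 4) * (1 / 2) ^ k"
          by (intro mult_left_mono power_decreasing) auto
        finally show "real n * \<epsilon> (k + K) \<le> (1 / 4) * (1 / 2) ^ k" .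
      qed
      also have "\<dots> = 1 / 2"
        by (subst suminf_mult) (simp_all add: suminf_geometric summable_geometric)
      finally show ?thesis by simp
    qed
    ultimately show ?thesis
      using saturation_sum_le[OF eps, of n K] unfolding a_def by linarith
  qed
  have "\<forall>\<^sub>F n in sequentially. a n < \<alpha> n"
    using a_less unfolding eventually_sequentially by blast
  moreover have "filterlim a at_top sequentially"
    unfolding a_def using eps by (rule saturation_sum_at_top)
  ultimately show ?thesis
    using a_mono a_0 a_pos saturation_sum_ratio[OF eps, folded a_def] by blast
qed

end
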